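(* Let $n\ge 2$ be an integer, let $d_1<d_2<\dots<d_w$ be all proper positive divisors of $n$, and for each $i$ let $A_{d_i}=\{x\in\{0,\dots,n-1\}:\gcd(x,n)=d_i\}$. Let $G_2$ be the induced subgraph of the comaximal graph $\Gamma(\mathbb{Z}_n)$ on the set of nonzero non-units of $\mathbb{Z}_n$. Then $V(G_2)=\bigcup_{i=1}^w A_{d_i}$ is an equitable partition of $G_2$.
   Context: The comaximal graph $\Gamma(\mathbb{Z}_n)$ has vertex set $\mathbb{Z}_n=\{0,1,\dots,n-1\}$, distinct $x,y$ adjacent iff $\langle x\rangle+\langle y\rangle=\mathbb{Z}_n$. A proper divisor of $n$ is a positive divisor different from $1$ and $n$. A partition $V(G)=V_1\cup\dots\cup V_k$ of the vertex set of a graph $G$ is equitable if for all $1\le i,j\le k$ every vertex of $V_i$ has the same number $b_{ij}$ of neighbours in $V_j$. *)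

theory Defs
  imports
    "HOL-Number_Theory.Residues"
    "HOL-Library.Disjoint_Sets"
    "Graph_Theory.Digraph_Component"
begin

text \<open>Undirected graphs are symmetric digraphs: an edge is the two arcs \<open>(x, y)\<close> and \<open>(y, x)\<close>.\<close>

definition comaximal_graph :: "('a, 'm) ring_scheme \<Rightarrow> ('a, 'a \<times> 'a) pre_digraph" where
  "comaximal_graph R =
     \<lparr>verts = carrier R,
      arcs = {(x, y). x \<in> carrier R \<and> y \<in> carrier R \<and> x \<noteq> y \<and>
                      Idl\<^bsub>R\<^esub> {x} <+>\<^bsub>R\<^esub> Idl\<^bsub>R\<^esub> {y} = carrier R},
      tail = fst, head = snd\<rparr>"

lemma (in ring) graph_comaximal_graph:
  assumes "finite (carrier R)"
  shows "graph (comaximal_graph R)"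
proof -
  let ?G = "comaximal_graph R"
  have ideal: "ideal (Idl {x}) R" if "x \<in> carrier R" for x
    by (rule genideal_ideal) (simp add: that)
  have sub: "Idl {x} \<subseteq> carrier R" if "x \<in> carrier R" for x
    by (rule additive_subgroup.a_subset[OF ideal.axioms(1)[OF ideal[OF that]]])
  have arcs_sym: "(y, x) \<in> arcs ?G" if "(x, y) \<in> arcs ?G" for x y
  proof -
    have "x \<in> carrier R" "y \<in> carrier R" "x \<noteq> y"
      and *: "Idl {x} <+>\<^bsub>R\<^esub> Idl {y} = carrier R"
      using that unfolding comaximal_graph_def by simp_all
    moreover from this have "Idl {y} <+>\<^bsub>R\<^esub> Idl {x} = carrier R"
      using set_add_comm[OF sub sub, of y x] by (simp only: *)
    ultimately show ?thesis
      unfolding comaximal_graph_def by auto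
  qed
  have ends: "arc_to_ends ?G e = e" for e
    unfolding comaximal_graph_def arc_to_ends_def by simp
  have arcs: "arcs ?G \<subseteq> carrier R \<times> carrier R"
    unfolding comaximal_graph_def by auto
  show ?thesis
  proof
    show "finite (verts ?G)"
      unfolding comaximal_graph_def by (simp add: assms)
    show "finite (arcs ?G)"
      by (rule finite_subset[OF arcs]) (simp add: assms)
    show "symmetric ?G"
      unfolding symmetric_def arcs_ends_def ends image_ident
      by (rule symI) (rule arcs_sym)
    show "e1 = e2" if "arc_to_ends ?G e1 = arc_to_ends ?G e2" for e1 e2
      using that by (simp only: ends)
    show "tail ?G e \<noteq> head ?G e" if "e \<in> arcs ?G" for e
      using that unfolding comaximal_graph_def by (cases e) simp
    show "tail ?G e \<in> verts ?G" if "e \<in> arcs ?G" for e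
      using that unfolding comaximal_graph_def by (cases e) simp
    show "head ?G e \<in> verts ?G" if "e \<in> arcs ?G" for e
      using that unfolding comaximal_graph_def by (cases e) simp
  qed
qed

definition comaximal_graph2 :: "('a, 'm) ring_scheme \<Rightarrow> ('a, 'a \<times> 'a) pre_digraph" where
  "comaximal_graph2 R =
     comaximal_graph R \<restriction> {x \<in> carrier R. x \<noteq> \<zero>\<^bsub>R\<^esub> \<and> x \<notin> Units R}"

definition proper_divisors :: "int \<Rightarrow> int set" where
  "proper_divisors n = {d. d > 0 \<and> d dvd n \<and> d \<noteq> 1 \<and> d \<noteq> n}"

definition gcd_cell :: "int \<Rightarrow> int \<Rightarrow> int set" where
  "gcd_cell n d = {x \<in> {0..n - 1}. gcd x n = d}"

text \<open>
  The parts are \<open>V 1, \<dots>, V k\<close>, required to be nonempty; the case \<open>k = 0\<close> is the empty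
  partition of the null graph. The definition is meant for finite graphs, because \<open>card\<close> is
  \<open>0\<close> on infinite sets.
\<close>

definition equitable_partition :: "('a, 'b) pre_digraph \<Rightarrow> nat \<Rightarrow> (nat \<Rightarrow> 'a set) \<Rightarrow> bool" where
  "equitable_partition G k V \<longleftrightarrow>
     verts G = (\<Union>i\<in>{1..k}. V i) \<and>
     disjoint_family_on V {1..k} \<and>
     (\<forall>i\<in>{1..k}. V i \<noteq> {}) \<and>
     (\<exists>b :: nat \<Rightarrow> nat \<Rightarrow> nat. \<forall>i\<in>{1..k}. \<forall>j\<in>{1..k}. \<forall>x\<in>V i.
        card {y \<in> V j. x \<rightarrow>\<^bsub>G\<^esub> y} = b i j)"

end

theory Submission
  imports Defs
begin

text \<open>
  In \<open>\<int>\<^sub>n\<close> the ideals generated by \<open>x\<close> and \<open>y\<close> are comaximal iff \<open>gcd x n\<close> and \<open>gcd y n\<close> are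
  coprime. Adjacency therefore depends only on the cells of \<open>x\<close> and \<open>y\<close>: between two cells either
  all pairs are joined or none, and there are no edges inside a cell, since its divisor is not 1.
\<close>

lemma (in residues) comaximal_iff_coprime:
  assumes "x \<in> carrier R" "y \<in> carrier R"
  shows "Idl {x} <+>\<^bsub>R\<^esub> Idl {y} = carrier R \<longleftrightarrow> coprime (gcd x m) (gcd y m)"
proof
  assume "Idl {x} <+>\<^bsub>R\<^esub> Idl {y} = carrier R"
  then have "\<one> \<in> PIdl x <+>\<^bsub>R\<^esub> PIdl y"
    using assms by (simp add: cgenideal_eq_genideal)
  then obtain r s where "\<one> = r \<otimes> x \<oplus> s \<otimes> y"
    unfolding cgenideal_def set_add_def' by auto
  then have rs: "1 = (r * x + s * y) mod m"
    by (simp add: res_one_eq res_add_eq res_mult_eq mod_simps)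
  show "coprime (gcd x m) (gcd y m)"
  proof (rule coprimeI)
    fix c assume "c dvd gcd x m" "c dvd gcd y m"
    \<comment> \<open>The divisor \<open>c\<close> divides \<open>m\<close> as well as
      \<open>x\<close> and \<open>y\<close>, so divisibility survives reduction modulo
      \<open>m\<close>.\<close>
    then have "c dvd (r * x + s * y) mod m"
      by (simp add: dvd_mod)
    then show "is_unit c" using rs by simp
  qed
next
  assume "coprime (gcd x m) (gcd y m)"
  \<comment> \<open>Both conditions say that the triple gcd of \<open>x\<close>, \<open>y\<close>
    and \<open>m\<close> is 1; this grouping allows two applications of Bezout.\<close>
  then have "coprime (gcd x y) m"
    by (auto simp: coprime_iff_gcd_eq_1 gcd.assoc gcd.left_commute)
  then obtain c e where ce: "c * gcd x y + e * m = 1"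
    using bezout_int[of "gcd x y" m] by auto
  obtain a b where ab: "a * x + b * y = gcd x y"
    using bezout_int by blast
  have "(c * a) * x + (c * b) * y = 1 + (- e) * m"
    using ce unfolding ab[symmetric] by (simp add: algebra_simps)
  then have "((c * a) * x + (c * b) * y) mod m = 1"
    using m_gt_one by (simp only: mod_mult_self1) simp
  \<comment> \<open>Scaling the Bezout coefficients of \<open>x\<close> and \<open>y\<close> by
    \<open>c\<close> represents 1 modulo \<open>m\<close>. They are reduced modulo \<open>m\<close>
    because multipliers in \<open>PIdl\<close> must lie in the carrier.\<close>
  then have one: "\<one> = ((c * a) mod m \<otimes> x) \<oplus> ((c * b) mod m \<otimes> y)"
    by (simp add: res_one_eq res_add_eq res_mult_eq mod_simps)
  have "ideal (Idl {x} <+>\<^bsub>R\<^esub> Idl {y}) R"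
    using assms by (intro add_ideals genideal_ideal) auto
  moreover have "\<one> \<in> PIdl x <+>\<^bsub>R\<^esub> PIdl y"
    unfolding cgenideal_def set_add_def' using one by auto
  then have "\<one> \<in> Idl {x} <+>\<^bsub>R\<^esub> Idl {y}"
    using assms by (simp add: cgenideal_eq_genideal)
  ultimately show "Idl {x} <+>\<^bsub>R\<^esub> Idl {y} = carrier R"
    by (rule ideal.one_imp_carrier)
qed

text \<open>Among the residues, units are exactly those with gcd 1 with \<open>m\<close>, and zero
  is the only one with gcd \<open>m\<close>.\<close>

lemma (in residues) verts_comaximal_graph2:
  "verts (comaximal_graph2 R) = (\<Union>d\<in>proper_divisors m. gcd_cell m d)"
proof -
  have "x \<in> {x \<in> carrier R. x \<noteq> \<zero> \<and> x \<notin> Units R} \<longleftrightarrow>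
      x \<in> {0..m - 1} \<and> gcd x m \<in> proper_divisors m" for x
  \<comment> \<open>For 0 < x < m the gcd is at most x, hence not \<open>m\<close>. The other case
    covers x = 0, where the gcd is \<open>m\<close>, and all x outside the carrier.\<close>
  proof (cases "x \<in> {0<..m - 1}")
    case True
    then have "gcd x m \<noteq> m"
      using gcd_le1_int[of x m] by (simp del: gcd_le1_int)
    then show ?thesis
      using True m_gt_one
      by (auto simp: res_carrier_eq res_zero_eq res_units_eq proper_divisors_def
            coprime_iff_gcd_eq_1)
  next
    case False
    then show ?thesis
      using m_gt_one by (auto simp: res_carrier_eq res_zero_eq proper_divisors_def)
  qed
  then show ?thesis
    by (auto simp: comaximal_graph2_def gcd_cell_def)
qed

lemma (in residues) comaximal_graph2_adj_iff:
  assumes "d \<in> proper_divisors m" "d' \<in> proper_divisors m"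
    and x: "x \<in> gcd_cell m d" and y: "y \<in> gcd_cell m d'"
  shows "x \<rightarrow>\<^bsub>comaximal_graph2 R\<^esub> y \<longleftrightarrow> coprime d d'"
proof -
  let ?S = "verts (comaximal_graph2 R)"
  have S: "x \<in> ?S" "y \<in> ?S"
    using assms by (auto simp: verts_comaximal_graph2)
  then have carrier: "x \<in> carrier R" "y \<in> carrier R"
    by (auto simp: comaximal_graph2_def)
  have "x \<rightarrow>\<^bsub>comaximal_graph2 R\<^esub> y \<longleftrightarrow> x \<noteq> y \<and> Idl {x} <+>\<^bsub>R\<^esub> Idl {y} = carrier R"
    using S carrier
    by (auto simp: comaximal_graph2_def comaximal_graph_def arcs_ends_def arc_to_ends_def image_iff)
  also have "\<dots> \<longleftrightarrow> x \<noteq> y \<and> coprime d d'"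
    using x y by (simp add: comaximal_iff_coprime[OF carrier] gcd_cell_def)
  \<comment> \<open>If x = y, then d = d', and d would be coprime to itself only for d = 1, which is
    not a proper divisor.\<close>
  also have "\<dots> \<longleftrightarrow> coprime d d'"
    using assms by (auto simp: gcd_cell_def proper_divisors_def coprime_iff_gcd_eq_1)
  finally show ?thesis .
qed

theorem theorem3p9:
  fixes n :: int and w :: nat and d :: "nat \<Rightarrow> int"
  assumes "n \<ge> 2"
    and "strict_mono_on {1..w} d"
    and "d ` {1..w} = proper_divisors n"
  shows "equitable_partition (comaximal_graph2 (residue_ring n)) w (\<lambda>i. gcd_cell n (d i))"
proof -
  interpret residues n "residue_ring n"
    using assms(1) by unfold_locales simp_all
  have d: "d i \<in> proper_divisors n" if "i \<in> {1..w}" for i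
    using that assms(3) by blast
  have inj: "inj_on d {1..w}"
    using assms(2) by (rule strict_mono_on_imp_inj_on)
  have "verts (comaximal_graph2 (residue_ring n)) = (\<Union>i\<in>{1..w}. gcd_cell n (d i))"
    by (simp add: verts_comaximal_graph2 flip: assms(3))
  moreover have "disjoint_family_on (\<lambda>i. gcd_cell n (d i)) {1..w}"
    unfolding disjoint_family_on_def
  proof (intro ballI impI)
    fix i j assume "i \<in> {1..w}" "j \<in> {1..w}" "i \<noteq> j"
    then have "d i \<noteq> d j"
      using inj by (meson inj_onD)
    then show "gcd_cell n (d i) \<inter> gcd_cell n (d j) = {}"
      by (auto simp: gcd_cell_def)
  qed
  moreover have "gcd_cell n (d i) \<noteq> {}" if "i \<in> {1..w}" for i
  proof -
    have "d i > 0" "d i dvd n" "d i \<noteq> n"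
      using d[OF that] by (simp_all add: proper_divisors_def)
    moreover from this have "d i \<le> n"
      using assms(1) by (intro zdvd_imp_le) auto
    \<comment> \<open>The divisor is its own witness; being strictly below \<open>n\<close>, it is
      one of the residues.\<close>
    ultimately have "d i \<in> gcd_cell n (d i)"
      by (simp add: gcd_cell_def gcd_proj1_if_dvd)
    then show ?thesis by blast
  qed
  moreover have "card {y \<in> gcd_cell n (d j). x \<rightarrow>\<^bsub>comaximal_graph2 (residue_ring n)\<^esub> y} =
      (if coprime (d i) (d j) then card (gcd_cell n (d j)) else 0)"
    if "i \<in> {1..w}" "j \<in> {1..w}" "x \<in> gcd_cell n (d i)" for i j x
  proof -
    \<comment> \<open>The condition on the right involves neither x nor y, so the set is the whole
      cell or empty.\<close>
    have "{y \<in> gcd_cell n (d j). x \<rightarrow>\<^bsub>comaximal_graph2 (residue_ring n)\<^esub> y} =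
        {y \<in> gcd_cell n (d j). coprime (d i) (d j)}"
      using comaximal_graph2_adj_iff[OF d[OF that(1)] d[OF that(2)] that(3)] by blast
    then show ?thesis by simp
  qed
  ultimately show ?thesis
    unfolding equitable_partition_def
    by (intro conjI exI[of _ "\<lambda>i j. if coprime (d i) (d j) then card (gcd_cell n (d j)) else 0"])
      simp_all
qed

end
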